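(* Let $G$, $W$, $\mathbb D$, $d$, $n$, $q=dn$, $V=W\oplus W$, $E_{\mathbb D}$, $r_{\mathbb D}=d+1$ and $Z$ be as in the context. Let $x_1,\dots,x_s\in S(V)$, $w_1,\dots,w_s>0$ with $\sum_iw_i=1$, and $Z_i=Z(x_i)$. Assume that $$\sum_i w_iZ_i=0,\qquad \sum_i w_i\,Z_i\otimes Z_i=\frac{1}{2(q+1)}I_{E_{\mathbb D}},$$ that at least one orbit $Gx_i$ is a spherical $2$-design, and that the completion is correction-weight optimal, i.e. $\sum_{i:\,Z_i\ne0}w_i=\frac{r_{\mathbb D}}{q+1}$. Then the number of correction orbits (indices $i$ with $Z_i\neq0$) is at least $$r_{\mathbb D}+1=d+2.$$ If this minimum is attained, then the weights $w_i$ of the correction orbits are all equal and the normalized defects $\sqrt2\,Z_i$ (over $i$ with $Z_i\ne0$) are the vertices of a regular simplex inscribed in the unit sphere $S(E_{\mathbb D})\simeq\mathbb D\mathbb P^1$: an equilateral triangle in $S^1$ if $\mathbb D=\mathbb R$, a regular tetrahedron in $S^2$ if $\mathbb D=\mathbb C$, and a regular $5$-simplex in $S^4$ if $\mathbb D=\mathbb H$.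
   Context: Let $G$ be a finite group and $W$ a nontrivial irreducible (finite-dimensional) real orthogonal $G$-module. Put $\mathbb D=\operatorname{End}_G(W)\in\{\mathbb R,\mathbb C,\mathbb H\}$ and regard $W$ as a right $\mathbb D$-module (in quaternionic type via $\operatorname{End}_G(W)^{\mathrm{op}}\simeq\mathbb H$). Put $d=\dim_{\mathbb R}\mathbb D\in\{1,2,4\}$, $n=\dim_{\mathbb D}W$, $q=\dim_{\mathbb R}W=dn$. Fix a $G$-invariant $\mathbb D$-Hermitian form $\langle\cdot,\cdot\rangle$ on $W$ (with $\langle xa,yb\rangle=\bar a\langle x,y\rangle b$) whose real part is the given real inner product. Let $V=W\oplus W$ with the diagonal $G$-action and the orthogonal direct sum inner product, $S(V)$ its unit sphere. For $x=(x_1,x_2)\in V$, the Hermitian Gram matrix is $H(x)=(\langle x_i,x_j\rangle)_{i,j}\in\operatorname{Herm}_2(\mathbb D)$. Let $E_{\mathbb D}$ be the real space of traceless matrices in $\operatorname{Herm}_2(\mathbb D)$ with inner product $\langle B,C\rangle_E=\operatorname{Re}\operatorname{tr}(BC)$, of real dimension $r_{\mathbb D}=d+1$, and $S(E_{\mathbb D})$ its unit sphere, identified with $\mathbb D\mathbb P^1$ via $[u]\mapsto\sqrt2(uu^*-\frac12I_2)$ ($u\in\mathbb D^2$, $\|u\|=1$). For $x\in S(V)$ the quadratic defect is $Z(x)=H(x)-\frac12I_2\in E_{\mathbb D}$; it is constant on $G$-orbits. An identity $\sum_i w_iZ_i\otimes Z_i=c\,I_{E_{\mathbb D}}$ means $\sum_i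 w_i\langle B,Z_i\rangle_E\langle C,Z_i\rangle_E=c\langle B,C\rangle_E$ for all $B,C\in E_{\mathbb D}$. A finite nonempty set $X\subset S(V)$ is a spherical $2$-design if $\frac1{|X|}\sum_{x\in X}f(x)$ equals the average of $f$ over $S(V)$ for every real polynomial $f$ of degree at most $2$. *)

theory Defs
  imports "HOL-Analysis.Analysis" "HOL-Algebra.Group_Action"
begin

section \<open>Quaternions\<close>

datatype quat = Quat (qRe: real) (qI: real) (qJ: real) (qK: real)

lemma quat_eq_iff:
  "x = y \<longleftrightarrow> qRe x = qRe y \<and> qI x = qI y \<and> qJ x = qJ y \<and> qK x = qK y"
  by (cases x; cases y) auto

instantiation quat :: division_ring
begin

definition "0 = Quat 0 0 0 0"
definition "1 = Quat 1 0 0 0"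
definition "x + y = Quat (qRe x + qRe y) (qI x + qI y) (qJ x + qJ y) (qK x + qK y)"
definition "- x = Quat (- qRe x) (- qI x) (- qJ x) (- qK x)"
definition "x - y = Quat (qRe x - qRe y) (qI x - qI y) (qJ x - qJ y) (qK x - qK y)"
definition "x * y = Quat
  (qRe x * qRe y - qI x * qI y - qJ x * qJ y - qK x * qK y)
  (qRe x * qI y + qI x * qRe y + qJ x * qK y - qK x * qJ y)
  (qRe x * qJ y - qI x * qK y + qJ x * qRe y + qK x * qI y)
  (qRe x * qK y + qI x * qJ y - qJ x * qI y + qK x * qRe y)"
definition "inverse x = (let N = (qRe x)\<^sup>2 + (qI x)\<^sup>2 + (qJ x)\<^sup>2 + (qK x)\<^sup>2 in
  Quat (qRe x / N) (- qI x / N) (- qJ x / N) (- qK x / N))"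
definition "x div y = x * inverse y" for x y :: quat

lemma quat_sel_basic [simp]:
  "qRe 0 = 0" "qI 0 = 0" "qJ 0 = 0" "qK 0 = 0"
  "qRe 1 = 1" "qI 1 = 0" "qJ 1 = 0" "qK 1 = 0"
  "qRe (x + y) = qRe x + qRe y" "qI (x + y) = qI x + qI y"
  "qJ (x + y) = qJ x + qJ y" "qK (x + y) = qK x + qK y"
  "qRe (- x) = - qRe x" "qI (- x) = - qI x" "qJ (- x) = - qJ x" "qK (- x) = - qK x"
  "qRe (x - y) = qRe x - qRe y" "qI (x - y) = qI x - qI y"
  "qJ (x - y) = qJ x - qJ y" "qK (x - y) = qK x - qK y"
  by (simp_all add: zero_quat_def one_quat_def plus_quat_def uminus_quat_def minus_quat_def)

lemma quat_sel_times [simp]: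
  "qRe (x * y) = qRe x * qRe y - qI x * qI y - qJ x * qJ y - qK x * qK y"
  "qI (x * y) = qRe x * qI y + qI x * qRe y + qJ x * qK y - qK x * qJ y"
  "qJ (x * y) = qRe x * qJ y - qI x * qK y + qJ x * qRe y + qK x * qI y"
  "qK (x * y) = qRe x * qK y + qI x * qJ y - qJ x * qI y + qK x * qRe y"
  by (simp_all add: times_quat_def)

lemma quat_sumsq_pos:
  "x \<noteq> 0 \<Longrightarrow> (qRe x)\<^sup>2 + (qI x)\<^sup>2 + (qJ x)\<^sup>2 + (qK x)\<^sup>2 > 0"
proof -
  assume "x \<noteq> 0"
  then have "(qRe x)\<^sup>2 > 0 \<or> (qI x)\<^sup>2 > 0 \<or> (qJ x)\<^sup>2 > 0 \<or> (qK x)\<^sup>2 > 0"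
    by (auto simp: quat_eq_iff)
  moreover have "(qRe x)\<^sup>2 \<ge> 0" "(qI x)\<^sup>2 \<ge> 0" "(qJ x)\<^sup>2 \<ge> 0" "(qK x)\<^sup>2 \<ge> 0" by simp_all
  ultimately show ?thesis by linarith
qed

instance
proof
  fix a b c :: quat
  show "a * b * c = a * (b * c)" "(a + b) * c = a * c + b * c" "a * (b + c) = a * b + a * c"
    by (simp_all add: quat_eq_iff algebra_simps)
  define N where "N = (qRe a)\<^sup>2 + (qI a)\<^sup>2 + (qJ a)\<^sup>2 + (qK a)\<^sup>2"
  have inv: "inverse a = Quat (qRe a / N) (- qI a / N) (- qJ a / N) (- qK a / N)"
    by (simp add: inverse_quat_def N_def Let_def)
  show "inverse a * a = 1" if "a \<noteq> 0"
  proof -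
    have N: "N \<noteq> 0" using quat_sumsq_pos[OF that] by (simp add: N_def)
    then show ?thesis
      by (simp add: quat_eq_iff inv divide_simps)
         (simp add: N_def power2_eq_square algebra_simps)
  qed
  show "a * inverse a = 1" if "a \<noteq> 0"
  proof -
    have N: "N \<noteq> 0" using quat_sumsq_pos[OF that] by (simp add: N_def)
    then show ?thesis
      by (simp add: quat_eq_iff inv divide_simps)
         (simp add: N_def power2_eq_square algebra_simps)
  qed
qed (simp_all add: quat_eq_iff divide_quat_def inverse_quat_def Let_def)

end

instantiation quat :: real_algebra_1
begin

definition "scaleR r x = Quat (r * qRe x) (r * qI x) (r * qJ x) (r * qK x)"

lemma quat_sel_scaleR [simp]:
  "qRe (r *\<^sub>R x) = r * qRe x" "qI (r *\<^sub>R x) = r * qI x"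
  "qJ (r *\<^sub>R x) = r * qJ x" "qK (r *\<^sub>R x) = r * qK x"
  by (simp_all add: scaleR_quat_def)

instance
  by standard (simp_all add: quat_eq_iff algebra_simps)

end

lemma quat_sel_of_real [simp]:
  "qRe (of_real r) = r" "qI (of_real r) = 0" "qJ (of_real r) = 0" "qK (of_real r) = 0"
  by (simp_all add: of_real_def)

instantiation quat :: real_inner
begin

definition inner_quat_def:
  "inner x y = qRe x * qRe y + qI x * qI y + qJ x * qJ y + qK x * qK y"
definition norm_quat_def: "norm (x :: quat) = sqrt (inner x x)"
definition sgn_quat_def: "sgn (x :: quat) = x /\<^sub>R norm x"
definition dist_quat_def: "dist (x :: quat) y = norm (x - y)"
definition uniformity_quat_def [code del]:
  "(uniformity :: (quat \<times> quat) filter) = (INF e\<in>{0 <..}. principal {(x, y). dist x y < e})"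
definition open_quat_def [code del]:
  "open (U :: quat set) \<longleftrightarrow> (\<forall>x\<in>U. eventually (\<lambda>(x', y). x' = x \<longrightarrow> y \<in> U) uniformity)"

instance
proof
  fix x y z :: quat and r :: real
  show "inner x x = 0 \<longleftrightarrow> x = 0"
    using quat_sumsq_pos[of x] by (cases "x = 0") (simp_all add: inner_quat_def power2_eq_square)
  show "open U \<longleftrightarrow> (\<forall>x\<in>U. eventually (\<lambda>(x', y). x' = x \<longrightarrow> y \<in> U) uniformity)"
    for U :: "quat set" by (rule open_quat_def)
  show "sgn x = x /\<^sub>R norm x" by (rule sgn_quat_def)
  show "dist x y = norm (x - y)" by (rule dist_quat_def)
  show "(uniformity :: (quat \<times> quat) filter) = (INF e\<in>{0 <..}. principal {(x, y). dist x y < e})"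
    by (rule uniformity_quat_def)
  show "norm x = sqrt (inner x x)" by (rule norm_quat_def)
  show "inner x y = inner y x" "inner (x + y) z = inner x z + inner y z"
    "inner (r *\<^sub>R x) y = r * inner x y" "0 \<le> inner x x"
    by (simp_all add: inner_quat_def algebra_simps)
qed

end

instantiation quat :: euclidean_space
begin

definition Basis_quat_def: "Basis = {Quat 1 0 0 0, Quat 0 1 0 0, Quat 0 0 1 0, Quat 0 0 0 1}"

instance
proof
  fix u v x :: quat
  show "inner u v = (if u = v then 1 else 0)" if "u \<in> Basis" "v \<in> Basis"
    using that unfolding Basis_quat_def by (elim insertE emptyE) (simp_all add: inner_quat_def)
  show "(\<forall>u\<in>Basis. inner x u = 0) \<longleftrightarrow> x = 0"
    unfolding Basis_quat_def ball_simps by (simp add: inner_quat_def quat_eq_iff[of x])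
qed (simp_all add: Basis_quat_def)

end

definition qcnj :: "quat \<Rightarrow> quat"
  where "qcnj x = Quat (qRe x) (- qI x) (- qJ x) (- qK x)"

lemma qcnj_sel [simp]:
  "qRe (qcnj x) = qRe x" "qI (qcnj x) = - qI x" "qJ (qcnj x) = - qJ x" "qK (qcnj x) = - qK x"
  by (simp_all add: qcnj_def)

lemma qcnj_mult: "qcnj (x * y) = qcnj y * qcnj x"
  by (simp add: quat_eq_iff algebra_simps)

lemma inner_quat_eq: "inner x y = qRe (qcnj x * y)"
  by (simp add: inner_quat_def)

lemma mult_qcnj: "x * qcnj x = of_real ((norm x)\<^sup>2)"
  by (simp add: power2_norm_eq_inner inner_quat_def quat_eq_iff)

lemma qcnj_mult_self: "qcnj x * x = of_real ((norm x)\<^sup>2)"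
  by (simp add: power2_norm_eq_inner inner_quat_def quat_eq_iff)

instance quat :: real_normed_div_algebra
proof
  fix x y :: quat
  have "inner (x * y) (x * y) = qRe (qcnj y * (qcnj x * x) * y)"
    by (simp only: inner_quat_eq qcnj_mult mult.assoc)
  also have "\<dots> = inner x x * inner y y"
    unfolding qcnj_mult_self power2_norm_eq_inner by (simp add: inner_quat_def algebra_simps)
  finally show "norm (x * y) = norm x * norm y"
    by (simp add: norm_quat_def real_sqrt_mult)
qed

text \<open>The real division algebras R, C, H, realised as the subalgebras
  R \<open>\<subseteq>\<close> C \<open>\<subseteq>\<close> H of the quaternions.\<close>

definition quat_complex :: "quat set"
  where "quat_complex = {a. qJ a = 0 \<and> qK a = 0}"

definition RCH :: "quat set set"
  where "RCH = {\<real>, quat_complex, UNIV}"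

lemma quat_Reals_iff: "a \<in> \<real> \<longleftrightarrow> qI a = 0 \<and> qJ a = 0 \<and> qK a = 0" for a :: quat
proof
  assume "qI a = 0 \<and> qJ a = 0 \<and> qK a = 0"
  then have "a = of_real (qRe a)" by (simp add: quat_eq_iff)
  then show "a \<in> \<real>" by (metis Reals_of_real)
qed (auto elim!: Reals_cases)

lemma RCH_subspace: "D \<in> RCH \<Longrightarrow> subspace D"
  by (auto simp: RCH_def quat_complex_def subspace_def quat_Reals_iff)

lemma RCH_closed:
  assumes "D \<in> RCH"
  shows "of_real r \<in> D" "1 \<in> D" "a \<in> D \<Longrightarrow> b \<in> D \<Longrightarrow> a * b \<in> D"
    "a \<in> D \<Longrightarrow> qcnj a \<in> D" "a \<in> D \<Longrightarrow> inverse a \<in> D"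
  using assms
  by (auto simp: RCH_def quat_complex_def quat_Reals_iff inverse_quat_def Let_def)

lemma dim_RCH:
  "dim (\<real> :: quat set) = 1" "dim quat_complex = 2" "dim (UNIV :: quat set) = 4"
proof -
  have "(\<real> :: quat set) = {a. \<forall>i\<in>Basis. i \<notin> {Quat 1 0 0 0} \<longrightarrow> a \<bullet> i = 0}"
    unfolding Basis_quat_def ball_simps by (auto simp: quat_Reals_iff inner_quat_def)
  then show "dim (\<real> :: quat set) = 1"
    using dim_substandard[of "{Quat 1 0 0 0}"] by (simp add: Basis_quat_def)
  have "quat_complex = {a. \<forall>i\<in>Basis. i \<notin> {Quat 1 0 0 0, Quat 0 1 0 0} \<longrightarrow> a \<bullet> i = 0}"
    unfolding Basis_quat_def ball_simps by (auto simp: quat_complex_def inner_quat_def)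
  then show "dim quat_complex = 2"
    using dim_substandard[of "{Quat 1 0 0 0, Quat 0 1 0 0}"] by (simp add: Basis_quat_def)
  show "dim (UNIV :: quat set) = 4"
    by (simp add: dim_UNIV Basis_quat_def)
qed


section \<open>Real orthogonal representations\<close>

definition orthogonal_rep :: "('g, 'm) monoid_scheme \<Rightarrow> ('g \<Rightarrow> 'w::euclidean_space \<Rightarrow> 'w) \<Rightarrow> bool"
  where "orthogonal_rep G \<rho> \<longleftrightarrow>
    group_action G UNIV \<rho> \<and> (\<forall>g\<in>carrier G. orthogonal_transformation (\<rho> g))"

definition irreducible_rep :: "('g, 'm) monoid_scheme \<Rightarrow> ('g \<Rightarrow> 'w::euclidean_space \<Rightarrow> 'w) \<Rightarrow> bool"
  where "irreducible_rep G \<rho> \<longleftrightarrow>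
    (\<forall>U. subspace U \<and> (\<forall>g\<in>carrier G. \<rho> g ` U \<subseteq> U) \<longrightarrow> U = {0} \<or> U = UNIV)"

definition trivial_rep :: "('g, 'm) monoid_scheme \<Rightarrow> ('g \<Rightarrow> 'w \<Rightarrow> 'w) \<Rightarrow> bool"
  where "trivial_rep G \<rho> \<longleftrightarrow> (\<forall>g\<in>carrier G. \<forall>x. \<rho> g x = x)"

definition End_G :: "('g, 'm) monoid_scheme \<Rightarrow> ('g \<Rightarrow> 'w::euclidean_space \<Rightarrow> 'w) \<Rightarrow> ('w \<Rightarrow> 'w) set"
  where "End_G G \<rho> = {f. linear f \<and> (\<forall>g\<in>carrier G. \<forall>x. f (\<rho> g x) = \<rho> g (f x))}"

definition diag_action :: "('g \<Rightarrow> 'w \<Rightarrow> 'w) \<Rightarrow> 'g \<Rightarrow> 'w \<times> 'w \<Rightarrow> 'w \<times> 'w"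
  where "diag_action \<rho> g = map_prod (\<rho> g) (\<rho> g)"

text \<open>\<open>rmul x a\<close> is \<open>x a\<close>.  The map sending \<open>a\<close> to right multiplication by \<open>a\<close> is an
  anti-isomorphism of real algebras from \<open>D\<close> onto \<open>End_G G \<rho>\<close>; for commutative \<open>D\<close> it is an
  isomorphism.\<close>

definition right_scalars ::
    "('g, 'm) monoid_scheme \<Rightarrow> ('g \<Rightarrow> 'w::euclidean_space \<Rightarrow> 'w) \<Rightarrow> quat set \<Rightarrow> ('w \<Rightarrow> quat \<Rightarrow> 'w) \<Rightarrow> bool"
  where "right_scalars G \<rho> D rmul \<longleftrightarrow>
    bij_betw (\<lambda>a x. rmul x a) D (End_G G \<rho>) \<and>
    (\<forall>x. \<forall>a\<in>D. \<forall>b\<in>D. rmul x (a + b) = rmul x a + rmul x b) \<and>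
    (\<forall>x r. \<forall>a\<in>D. rmul x (r *\<^sub>R a) = r *\<^sub>R rmul x a) \<and>
    (\<forall>x. \<forall>a\<in>D. \<forall>b\<in>D. rmul x (a * b) = rmul (rmul x a) b) \<and>
    (\<forall>x. rmul x 1 = x)"

definition right_spanning :: "quat set \<Rightarrow> ('w::euclidean_space \<Rightarrow> quat \<Rightarrow> 'w) \<Rightarrow> 'w set \<Rightarrow> bool"
  where "right_spanning D rmul B \<longleftrightarrow>
    finite B \<and> (\<forall>x. \<exists>c. (\<forall>b\<in>B. c b \<in> D) \<and> x = (\<Sum>b\<in>B. rmul b (c b)))"

definition right_dim :: "quat set \<Rightarrow> ('w::euclidean_space \<Rightarrow> quat \<Rightarrow> 'w) \<Rightarrow> nat"
  where "right_dim D rmul = (LEAST n. \<exists>B. right_spanning D rmul B \<and> card B = n)"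

definition invariant_hermitian_form ::
    "('g, 'm) monoid_scheme \<Rightarrow> ('g \<Rightarrow> 'w::euclidean_space \<Rightarrow> 'w) \<Rightarrow> quat set \<Rightarrow> ('w \<Rightarrow> quat \<Rightarrow> 'w)
      \<Rightarrow> ('w \<Rightarrow> 'w \<Rightarrow> quat) \<Rightarrow> bool"
  where "invariant_hermitian_form G \<rho> D rmul h \<longleftrightarrow>
    (\<forall>x y. h x y \<in> D) \<and>
    (\<forall>x y z. h (x + y) z = h x z + h y z) \<and>
    (\<forall>x y z. h x (y + z) = h x y + h x z) \<and>
    (\<forall>x y. \<forall>a\<in>D. \<forall>b\<in>D. h (rmul x a) (rmul y b) = qcnj a * h x y * b) \<and>
    (\<forall>x y. h y x = qcnj (h x y)) \<and>
    (\<forall>g\<in>carrier G. \<forall>x y. h (\<rho> g x) (\<rho> g y) = h x y) \<and>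
    (\<forall>x y. qRe (h x y) = x \<bullet> y)"

lemma right_dim_eq:
  fixes rmul :: "'w::euclidean_space \<Rightarrow> quat \<Rightarrow> 'w"
  assumes D: "D \<in> RCH" and rs: "right_scalars G \<rho> D rmul"
  shows "DIM('w) = dim D * right_dim D rmul"
proof -
  note sD = RCH_subspace[OF D] and cD = RCH_closed[OF D]
  have add: "rmul x (a + b) = rmul x a + rmul x b" if "a \<in> D" "b \<in> D" for x a b
    using rs that by (auto simp: right_scalars_def)
  have scl: "rmul x (r *\<^sub>R a) = r *\<^sub>R rmul x a" if "a \<in> D" for x a r
    using rs that by (auto simp: right_scalars_def)
  have mul: "rmul x (a * b) = rmul (rmul x a) b" if "a \<in> D" "b \<in> D" for x a b
    using rs that by (auto simp: right_scalars_def)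
  have one: "rmul x 1 = x" for x using rs by (auto simp: right_scalars_def)
  have lin: "linear (\<lambda>x. rmul x a)" if "a \<in> D" for a
    using rs that by (auto simp: right_scalars_def bij_betw_def End_G_def)
  have zero: "rmul x 0 = 0" for x using scl[of 1 x 0] cD(2) by simp
  have sm: "rmul x (\<Sum>e\<in>E. k e *\<^sub>R e) = (\<Sum>e\<in>E. k e *\<^sub>R rmul x e)"
    if "finite E" "E \<subseteq> D" for x E and k :: "quat \<Rightarrow> real"
    using that
  proof (induction E)
    case (insert e E)
    have "(\<Sum>e\<in>E. k e *\<^sub>R e) \<in> D"
      using insert.prems by (intro subspace_sum[OF sD] subspace_scale[OF sD]) auto
    moreover have "k e *\<^sub>R e \<in> D" using insert.prems subspace_scale[OF sD] by auto
    ultimately show ?case using insert by (simp add: add scl)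
  qed (simp add: zero)
  have "right_spanning D rmul Basis"
    unfolding right_spanning_def
  proof (intro conjI allI finite_Basis exI ballI)
    fix x :: 'w
    have "rmul b (of_real (x \<bullet> b)) = (x \<bullet> b) *\<^sub>R b" for b
      using scl[of 1 b "x \<bullet> b"] cD(2) one by (simp add: of_real_def)
    then show "x = (\<Sum>b\<in>Basis. rmul b (of_real (x \<bullet> b)))"
      by (simp add: euclidean_representation)
  qed (rule cD)
  then have "\<exists>n B. right_spanning D rmul B \<and> card B = n" by blast
  from LeastI_ex[OF this] obtain B where B: "right_spanning D rmul B" "card B = right_dim D rmul"
    unfolding right_dim_def by blast
  have minB: "card B \<le> card B'" if "right_spanning D rmul B'" for B'
    unfolding B(2) right_dim_def using that by (intro Least_le) auto
  have fB: "finite B" using B(1) by (simp add: right_spanning_def)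
  have indB: "c b0 = 0" if c: "\<forall>b\<in>B. c b \<in> D" "(\<Sum>b\<in>B. rmul b (c b)) = 0" and b0: "b0 \<in> B" for c b0
  proof (rule ccontr)
    assume ne: "c b0 \<noteq> 0"
    define u where "u = - inverse (c b0)"
    have uD: "u \<in> D" using cD(5) c(1) b0 subspace_neg[OF sD] by (auto simp: u_def)
    have "rmul b0 (c b0) = - (\<Sum>b\<in>B - {b0}. rmul b (c b))"
      using c(2) sum.remove[OF fB b0, of "\<lambda>b. rmul b (c b)"] by (simp add: eq_neg_iff_add_eq_0)
    then have "rmul (rmul b0 (c b0)) (inverse (c b0))
        = rmul (- (\<Sum>b\<in>B - {b0}. rmul b (c b))) (inverse (c b0))" by simp
    moreover have "rmul (rmul b0 (c b0)) (inverse (c b0)) = b0"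
      using mul[of "c b0" "inverse (c b0)" b0] c(1) b0 cD(5) ne one by simp
    moreover have "rmul (- (\<Sum>b\<in>B - {b0}. rmul b (c b))) (inverse (c b0))
        = rmul (\<Sum>b\<in>B - {b0}. rmul b (c b)) u"
      using linear_neg[OF lin] scl[of "inverse (c b0)" _ "-1"] c(1) b0 cD(5) by (simp add: u_def)
    moreover have "rmul (\<Sum>b\<in>B - {b0}. rmul b (c b)) u = (\<Sum>b\<in>B - {b0}. rmul b (c b * u))"
      using mul uD c(1) by (simp add: linear_sum[OF lin[OF uD]])
    ultimately have b0_eq: "b0 = (\<Sum>b\<in>B - {b0}. rmul b (c b * u))" by simp
    have "right_spanning D rmul (B - {b0})"
      unfolding right_spanning_def
    proof (intro conjI allI)
      fix x
      obtain k where k: "\<forall>b\<in>B. k b \<in> D" "x = (\<Sum>b\<in>B. rmul b (k b))"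
        using B(1) unfolding right_spanning_def by blast
      have "rmul b0 (k b0) = (\<Sum>b\<in>B - {b0}. rmul (rmul b (c b * u)) (k b0))"
        by (subst b0_eq) (use linear_sum[OF lin] k(1) b0 in auto)
      also have "\<dots> = (\<Sum>b\<in>B - {b0}. rmul b (c b * u * k b0))"
        using c(1) uD k(1) b0 cD(3) by (intro sum.cong refl mul[symmetric]) auto
      finally have "x = (\<Sum>b\<in>B - {b0}. rmul b (c b * u * k b0)) + (\<Sum>b\<in>B - {b0}. rmul b (k b))"
        using k(2) sum.remove[OF fB b0, of "\<lambda>b. rmul b (k b)"] by simp
      also have "\<dots> = (\<Sum>b\<in>B - {b0}. rmul b (c b * u * k b0 + k b))"
        unfolding sum.distrib[symmetric]
        using c(1) uD k(1) b0 cD(3) by (intro sum.cong refl add[symmetric]) auto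
      finally show "\<exists>k. (\<forall>b\<in>B - {b0}. k b \<in> D) \<and> x = (\<Sum>b\<in>B - {b0}. rmul b (k b))"
        using c(1) uD k(1) b0 cD(3) subspace_add[OF sD]
        by (intro exI[of _ "\<lambda>b. c b * u * k b0 + k b"]) auto
    qed (use fB in auto)
    from minB[OF this] show False using fB b0 by (meson card_Diff1_less not_le)
  qed
  obtain E where E: "E \<subseteq> D" "independent E" "D \<subseteq> span E" "card E = dim D"
    using basis_exists by blast
  have fE: "finite E" using E(2) by (rule independent_imp_finite)
  define T where "T = (\<lambda>(b, e). rmul b e) ` (B \<times> E)"
  have key: "k (b, e) = 0"
    if z: "(\<Sum>b\<in>B. \<Sum>e\<in>E. k (b, e) *\<^sub>R rmul b e) = 0" and "b \<in> B" "e \<in> E"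
    for k :: "'w \<times> quat \<Rightarrow> real" and b e
  proof -
    have "(\<Sum>e\<in>E. k (b, e) *\<^sub>R e) = 0"
    proof (rule indB[where c = "\<lambda>b. \<Sum>e\<in>E. k (b, e) *\<^sub>R e"])
      show "\<forall>b\<in>B. (\<Sum>e\<in>E. k (b, e) *\<^sub>R e) \<in> D"
        using E(1) by (intro ballI subspace_sum[OF sD] subspace_scale[OF sD]) auto
      show "(\<Sum>b\<in>B. rmul b (\<Sum>e\<in>E. k (b, e) *\<^sub>R e)) = 0"
        using z sm[OF fE E(1), of _ "\<lambda>e. k (_, e)"] by simp
    qed fact
    then show ?thesis using E(2) fE \<open>e \<in> E\<close> by (auto simp: independent_explicit)
  qed
  have inj: "inj_on (\<lambda>(b, e). rmul b e) (B \<times> E)"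
  proof (rule inj_onI, rule ccontr)
    fix p p' assume p: "p \<in> B \<times> E" "p' \<in> B \<times> E" and ne: "p \<noteq> p'"
      and eq: "(\<lambda>(b, e). rmul b e) p = (\<lambda>(b, e). rmul b e) p'"
    define k :: "'w \<times> quat \<Rightarrow> real"
      where "k z = (if z = p then 1 else 0) - (if z = p' then 1 else 0)" for z
    have "(\<Sum>b\<in>B. \<Sum>e\<in>E. k (b, e) *\<^sub>R rmul b e) = (\<Sum>z\<in>B \<times> E. k z *\<^sub>R (\<lambda>(b, e). rmul b e) z)"
      by (simp add: sum.cartesian_product case_prod_unfold)
    also have "\<dots> = (\<lambda>(b, e). rmul b e) p - (\<lambda>(b, e). rmul b e) p'"
      using p fB fE
      by (simp add: k_def scaleR_diff_left sum_subtractf if_distrib[of "\<lambda>r. r *\<^sub>R _"] cong: if_cong)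
    finally have "(\<Sum>b\<in>B. \<Sum>e\<in>E. k (b, e) *\<^sub>R rmul b e) = 0" using eq by simp
    from key[OF this, of "fst p" "snd p"] p ne show False by (auto simp: k_def)
  qed
  have "independent T"
    unfolding independent_explicit
  proof (intro conjI allI impI ballI)
    show "finite T" using fB fE by (simp add: T_def)
    fix k v assume z: "(\<Sum>v\<in>T. k v *\<^sub>R v) = 0" and "v \<in> T"
    then obtain b e where v: "b \<in> B" "e \<in> E" "v = rmul b e" by (auto simp: T_def)
    have "(\<Sum>b\<in>B. \<Sum>e\<in>E. k (rmul b e) *\<^sub>R rmul b e) = 0"
      using z unfolding T_def sum.reindex[OF inj]
      by (simp add: sum.cartesian_product case_prod_unfold)
    then show "k v = 0" using key[of "\<lambda>(b, e). k (rmul b e)" b e] v by simp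
  qed
  moreover have "span T = UNIV"
  proof -
    have "x \<in> span T" for x
    proof -
      obtain k where k: "\<forall>b\<in>B. k b \<in> D" "x = (\<Sum>b\<in>B. rmul b (k b))"
        using B(1) unfolding right_spanning_def by blast
      have "rmul b (k b) \<in> span T" if b: "b \<in> B" for b
      proof -
        have "k b \<in> span E" using k(1) b E(3) by auto
        then obtain f where "k b = (\<Sum>e\<in>E. f e *\<^sub>R e)" using span_finite[OF fE] by auto
        then have "rmul b (k b) = (\<Sum>e\<in>E. f e *\<^sub>R rmul b e)" using sm[OF fE E(1)] by simp
        also have "\<dots> \<in> span T"
          using b by (intro span_sum span_scale span_base) (auto simp: T_def)
        finally show ?thesis .
      qed
      then show ?thesis unfolding k(2) by (intro span_sum)
    qed
    then show ?thesis by auto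
  qed
  ultimately have "DIM('w) = card T"
    by (metis dim_UNIV dim_span_eq_card_independent)
  also have "\<dots> = card B * card E"
    unfolding T_def using card_image[OF inj] card_cartesian_product[of B E] by simp
  finally show ?thesis using B(2) E(4) by simp
qed


section \<open>Traceless Hermitian matrices, Gram matrices and quadratic defects\<close>

definition Herm2 :: "quat set \<Rightarrow> (quat^2^2) set"
  where "Herm2 D = {B. \<forall>i j. B $ i $ j \<in> D \<and> B $ j $ i = qcnj (B $ i $ j)}"

definition traceless_Herm :: "quat set \<Rightarrow> (quat^2^2) set"
  where "traceless_Herm D = {B \<in> Herm2 D. trace B = 0}"

definition E_inner :: "quat^2^2 \<Rightarrow> quat^2^2 \<Rightarrow> real"
  where "E_inner B C = qRe (trace (B ** C))"

definition E_sphere :: "quat set \<Rightarrow> (quat^2^2) set"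
  where "E_sphere D = {B \<in> traceless_Herm D. E_inner B B = 1}"

definition gram :: "('w \<Rightarrow> 'w \<Rightarrow> quat) \<Rightarrow> 'w \<times> 'w \<Rightarrow> quat^2^2"
  where "gram h x = vector [vector [h (fst x) (fst x), h (fst x) (snd x)],
                            vector [h (snd x) (fst x), h (snd x) (snd x)]]"

definition defect :: "('w \<Rightarrow> 'w \<Rightarrow> quat) \<Rightarrow> 'w \<times> 'w \<Rightarrow> quat^2^2"
  where "defect h x = gram h x - (1/2) *\<^sub>R mat 1"

lemma Herm2D:
  assumes "B \<in> Herm2 D"
  shows "B $ i $ j \<in> D" "B $ j $ i = qcnj (B $ i $ j)"
  using assms[unfolded Herm2_def mem_Collect_eq, rule_format, of i j]
  by (rule conjunct1 conjunct2)+

lemma traceless_HermI: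
  assumes "\<And>i j. B $ i $ j \<in> D" "\<And>i j. B $ j $ i = qcnj (B $ i $ j)" "trace B = 0"
  shows "B \<in> traceless_Herm D"
  unfolding traceless_Herm_def Herm2_def by (intro CollectI conjI allI assms)

lemma Herm2_entries:
  assumes "B \<in> Herm2 D"
  shows "qI (B $ i $ i) = 0" "qJ (B $ i $ i) = 0" "qK (B $ i $ i) = 0"
    "qRe (B $ 2 $ 1) = qRe (B $ 1 $ 2)" "qI (B $ 2 $ 1) = - qI (B $ 1 $ 2)"
    "qJ (B $ 2 $ 1) = - qJ (B $ 1 $ 2)" "qK (B $ 2 $ 1) = - qK (B $ 1 $ 2)"
proof -
  note * = Herm2D(2)[OF assms]
  show "qI (B $ i $ i) = 0" "qJ (B $ i $ i) = 0" "qK (B $ i $ i) = 0"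
    using *[of i i, unfolded quat_eq_iff] by simp_all
  show "qRe (B $ 2 $ 1) = qRe (B $ 1 $ 2)" "qI (B $ 2 $ 1) = - qI (B $ 1 $ 2)"
    "qJ (B $ 2 $ 1) = - qJ (B $ 1 $ 2)" "qK (B $ 2 $ 1) = - qK (B $ 1 $ 2)"
    using *[of 2 1, unfolded quat_eq_iff] by simp_all
qed

text \<open>On Hermitian matrices \<open>E_inner\<close> is the library inner product, so the library norm,
  distance and dimension on \<^typ>\<open>quat^2^2\<close> are those of the Euclidean space
  \<open>(traceless_Herm D, E_inner)\<close>.\<close>

lemma E_inner_eq_inner:
  assumes "B \<in> Herm2 D"
  shows "E_inner B C = B \<bullet> C"
proof -
  have "E_inner B C = (B $ 1 $ 1 \<bullet> C $ 1 $ 1 + B $ 1 $ 2 \<bullet> C $ 1 $ 2) + (B $ 2 $ 1 \<bullet> C $ 2 $ 1 + B $ 2 $ 2 \<bullet> C $ 2 $ 2)"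
    unfolding E_inner_def trace_def matrix_matrix_mult_def inner_quat_def sum_2 vec_lambda_beta
      quat_sel_basic quat_sel_times Herm2_entries[OF assms]
    by simp
  then show ?thesis by (simp add: inner_vec_def sum_2)
qed

lemma subspace_traceless_Herm:
  assumes "D \<in> RCH"
  shows "subspace (traceless_Herm D)"
proof -
  note s = RCH_subspace[OF assms]
  have q: "qcnj 0 = 0" "qcnj (a + b) = qcnj a + qcnj b" "qcnj (r *\<^sub>R a) = r *\<^sub>R qcnj a" for a b r
    by (simp_all add: quat_eq_iff)
  show ?thesis
  proof (rule subspaceI)
    show "0 \<in> traceless_Herm D"
      using subspace_0[OF s] by (simp add: traceless_Herm_def Herm2_def trace_def q)
    fix B C r assume "B \<in> traceless_Herm D"
    then have B: "B \<in> Herm2 D" "trace B = 0" by (simp_all add: traceless_Herm_def)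
    have "trace (r *\<^sub>R B) = r *\<^sub>R trace B" by (simp add: trace_def scaleR_sum_right)
    moreover have "(r *\<^sub>R B) $ i $ j \<in> D" "(r *\<^sub>R B) $ j $ i = qcnj ((r *\<^sub>R B) $ i $ j)" for i j
      using subspace_scale[OF s Herm2D(1)[OF B(1)]] Herm2D(2)[OF B(1), of j i] by (simp_all add: q)
    ultimately show "r *\<^sub>R B \<in> traceless_Herm D"
      using B(2) by (metis traceless_HermI scaleR_zero_right)
    assume "C \<in> traceless_Herm D"
    then have C: "C \<in> Herm2 D" "trace C = 0" by (simp_all add: traceless_Herm_def)
    have "trace (B + C) = trace B + trace C" by (simp add: trace_def sum.distrib)
    moreover have "(B + C) $ i $ j \<in> D" "(B + C) $ j $ i = qcnj ((B + C) $ i $ j)" for i j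
      using subspace_add[OF s Herm2D(1)[OF B(1)] Herm2D(1)[OF C(1)]]
        Herm2D(2)[OF B(1), of j i] Herm2D(2)[OF C(1), of j i] by (simp_all add: q)
    ultimately show "B + C \<in> traceless_Herm D"
      using B(2) C(2) by (metis traceless_HermI add.right_neutral)
  qed
qed

lemma dist_eq_E_inner:
  assumes "D \<in> RCH" "B \<in> traceless_Herm D" "C \<in> traceless_Herm D"
  shows "dist B C = sqrt (E_inner (B - C) (B - C))"
proof -
  have "B - C \<in> Herm2 D"
    using subspace_diff[OF subspace_traceless_Herm[OF assms(1)] assms(2,3)]
    by (simp add: traceless_Herm_def)
  then show ?thesis by (simp add: E_inner_eq_inner dist_norm norm_eq_sqrt_inner)
qed

lemma traceless_Herm_eq:
  assumes D: "D \<in> RCH"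
  shows "traceless_Herm D =
    (\<lambda>(t, b). vector [vector [of_real t, b], vector [qcnj b, - of_real t]]) ` (UNIV \<times> D)"
    (is "_ = ?f ` _")
proof (intro equalityI subsetI)
  fix B assume B: "B \<in> traceless_Herm D"
  then have H: "B \<in> Herm2 D" "B $ 1 $ 2 \<in> D"
    unfolding traceless_Herm_def by (blast intro: Herm2D(1))+
  have "B $ 2 $ 2 = - B $ 1 $ 1"
    using B unfolding traceless_Herm_def
    by (simp add: trace_def sum_2 eq_neg_iff_add_eq_0 add.commute)
  then have "B = ?f (qRe (B $ 1 $ 1), B $ 1 $ 2)"
    by (simp add: vec_eq_iff forall_2 quat_eq_iff Herm2_entries[OF H(1)])
  then show "B \<in> ?f ` (UNIV \<times> D)" using H(2) by blast
next
  fix B assume "B \<in> ?f ` (UNIV \<times> D)"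
  then obtain t b where b: "b \<in> D" and B: "B = ?f (t, b)" by auto
  have "- of_real t \<in> D" using subspace_neg[OF RCH_subspace[OF D]] RCH_closed(1)[OF D] by blast
  moreover have "qcnj (of_real t) = of_real t" "qcnj (- of_real t) = - of_real t" "qcnj (qcnj b) = b"
    by (simp_all add: quat_eq_iff)
  ultimately show "B \<in> traceless_Herm D"
    using b RCH_closed[OF D] by (simp add: B traceless_Herm_def Herm2_def forall_2 trace_def sum_2)
qed

lemma dim_traceless_Herm:
  assumes D: "D \<in> RCH"
  shows "dim (traceless_Herm D) = dim D + 1"
proof -
  define f :: "real \<times> quat \<Rightarrow> quat^2^2" where
    "f = (\<lambda>(t, b). vector [vector [of_real t, b], vector [qcnj b, - of_real t]])"
  have lin: "linear f"
    by (rule linearI) (auto simp: f_def vec_eq_iff forall_2 quat_eq_iff)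
  have inj: "inj f"
    by (rule injI) (auto simp: f_def vec_eq_iff forall_2)
  have "dim (traceless_Herm D) = dim ((UNIV :: real set) \<times> D)"
    unfolding traceless_Herm_eq[OF D] f_def[symmetric]
    by (rule dim_image_eq[OF lin]) (rule inj_on_subset[OF inj subset_UNIV])
  also have "\<dots> = dim D + 1"
    using dim_Times[of "UNIV :: real set" D] RCH_subspace[OF D] by (simp add: dim_UNIV)
  finally show ?thesis .
qed

lemma defect_in_traceless_Herm:
  assumes D: "D \<in> RCH" and "invariant_hermitian_form G \<rho> D rmul h" and x: "x \<in> sphere 0 1"
  shows "defect h x \<in> traceless_Herm D"
proof -
  note h = assms(2)[unfolded invariant_hermitian_form_def]
  have c: "h z y = qcnj (h y z)" "h y z \<in> D" "qRe (h y z) = y \<bullet> z" for y z using h by blast+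
  have imag: "qI (h y y) = 0" "qJ (h y y) = 0" "qK (h y y) = 0" for y
    using c(1)[of y y, unfolded quat_eq_iff] by simp_all
  define t where "t = fst x \<bullet> fst x - 1/2"
  have "snd x \<bullet> snd x = 1/2 - t"
    using x by (simp add: t_def norm_eq_sqrt_inner inner_prod_def)
  moreover have "qRe (1/2) = 1/2" "qI (1/2) = 0" "qJ (1/2) = 0" "qK (1/2) = 0"
    using quat_sel_of_real[of "1/2"] by simp_all
  ultimately have "defect h x =
      (\<lambda>(t, b). vector [vector [of_real t, b], vector [qcnj b, - of_real t]]) (t, h (fst x) (snd x))"
    using c(1)[of "snd x" "fst x"]
    by (simp add: defect_def gram_def mat_def vec_eq_iff forall_2 quat_eq_iff[of "h _ _ - _"]
        imag c(3) t_def)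
  then show ?thesis unfolding traceless_Herm_eq[OF D] using c(2) by blast
qed

lemma defect_diag_action:
  assumes "invariant_hermitian_form G \<rho> D rmul h" "g \<in> carrier G"
  shows "defect h (diag_action \<rho> g x) = defect h x"
proof -
  have "h (\<rho> g y) (\<rho> g z) = h y z" for y z
    using assms unfolding invariant_hermitian_form_def by meson
  then show ?thesis by (simp add: defect_def gram_def diag_action_def)
qed


subsection \<open>The unit sphere of the traceless Hermitian matrices as a projective line\<close>

definition unit_vecs :: "quat set \<Rightarrow> (quat^2) set"
  where "unit_vecs D = {u. (\<forall>i. u $ i \<in> D) \<and> norm u = 1}"

definition proj_emb :: "quat^2 \<Rightarrow> quat^2^2"
  where "proj_emb u = sqrt 2 *\<^sub>R ((\<chi> i j. u $ i * qcnj (u $ j)) - (1/2) *\<^sub>R mat 1)"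

lemma norm_eq_1_if_sq: "norm x = 1" if "(norm x)\<^sup>2 = 1" for x :: "'v::real_normed_vector"
  using that power2_eq_imp_eq[of "norm x" 1] by simp

lemma norm_sq_vec2: "(norm u)\<^sup>2 = (norm (u $ 1))\<^sup>2 + (norm (u $ 2))\<^sup>2" for u :: "quat^2"
  by (simp add: norm_vec_def L2_set_def sum_2)

lemma proj_emb_form:
  assumes "norm u = 1"
  shows "proj_emb u = (\<lambda>(t, b). vector [vector [of_real t, b], vector [qcnj b, - of_real t]])
    (sqrt 2 * ((norm (u $ 1))\<^sup>2 - 1/2), sqrt 2 *\<^sub>R (u $ 1 * qcnj (u $ 2)))"
proof -
  have c: "proj_emb u $ i $ j = sqrt 2 *\<^sub>R (u $ i * qcnj (u $ j) - (1/2) *\<^sub>R (if i = j then 1 else 0))"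
    for i j by (simp add: proj_emb_def mat_def)
  have r: "a *\<^sub>R (of_real b - (1/2) *\<^sub>R 1) = (of_real (a * (b - 1/2)) :: quat)" for a b
    by (simp only: quat_eq_iff quat_sel_basic quat_sel_scaleR quat_sel_of_real) simp
  have "(norm (u $ 2))\<^sup>2 - 1/2 = - ((norm (u $ 1))\<^sup>2 - 1/2)"
    using norm_sq_vec2[of u] assms by simp
  then have "proj_emb u $ 2 $ 2 = of_real (sqrt 2 * - ((norm (u $ 1))\<^sup>2 - 1/2))"
    unfolding c mult_qcnj by (simp only: r if_True simp_thms)
  then have "proj_emb u $ 2 $ 2 = - of_real (sqrt 2 * ((norm (u $ 1))\<^sup>2 - 1/2))"
    by (simp only: mult_minus_right of_real_minus)
  moreover have "proj_emb u $ 1 $ 1 = of_real (sqrt 2 * ((norm (u $ 1))\<^sup>2 - 1/2))"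
    unfolding c mult_qcnj by (simp only: r if_True simp_thms)
  moreover have "proj_emb u $ 1 $ 2 = sqrt 2 *\<^sub>R (u $ 1 * qcnj (u $ 2))" by (simp add: c)
  moreover have "proj_emb u $ 2 $ 1 = qcnj (sqrt 2 *\<^sub>R (u $ 1 * qcnj (u $ 2)))"
    by (simp add: c quat_eq_iff algebra_simps)
  ultimately show ?thesis by (simp only: vec_eq_iff forall_2 vector_2 case_prod_conv)
qed

lemma E_inner_form:
  "E_inner (vector [vector [of_real t, b], vector [qcnj b, - of_real t]])
     (vector [vector [of_real t, b], vector [qcnj b, - of_real t]]) = 2 * t\<^sup>2 + 2 * (norm b)\<^sup>2"
proof -
  have "(norm b)\<^sup>2 = (qRe b)\<^sup>2 + (qI b)\<^sup>2 + (qJ b)\<^sup>2 + (qK b)\<^sup>2"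
    unfolding power2_norm_eq_inner inner_quat_def by (simp add: power2_eq_square)
  then show ?thesis
    unfolding E_inner_def trace_def matrix_matrix_mult_def sum_2 vec_lambda_beta vector_2
      quat_sel_basic quat_sel_times quat_sel_of_real qcnj_sel
    by (simp add: power2_eq_square)
qed

lemma proj_emb_image:
  assumes D: "D \<in> RCH"
  shows "proj_emb ` unit_vecs D = E_sphere D"
proof (intro equalityI subsetI)
  fix B assume "B \<in> proj_emb ` unit_vecs D"
  then obtain u where u: "\<forall>i. u $ i \<in> D" "norm u = 1" and B: "B = proj_emb u"
    by (auto simp: unit_vecs_def)
  define p where "p = (norm (u $ 1))\<^sup>2"
  have p2: "(norm (u $ 2))\<^sup>2 = 1 - p" using norm_sq_vec2[of u] u(2) by (simp add: p_def)
  have "sqrt 2 *\<^sub>R (u $ 1 * qcnj (u $ 2)) \<in> D"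
    using u(1) RCH_closed(3,4)[OF D] subspace_scale[OF RCH_subspace[OF D]] by blast
  then have "B \<in> traceless_Herm D"
    unfolding B proj_emb_form[OF u(2)] traceless_Herm_eq[OF D] by blast
  moreover have "(norm (sqrt 2 *\<^sub>R (u $ 1 * qcnj (u $ 2))))\<^sup>2 = 2 * (p * (1 - p))"
  proof -
    have "norm (qcnj (u $ 2)) = norm (u $ 2)" by (simp add: norm_quat_def inner_quat_def)
    then show ?thesis by (simp add: norm_mult power_mult_distrib p2 p_def[symmetric])
  qed
  moreover have "E_inner B B =
      2 * (sqrt 2 * (p - 1/2))\<^sup>2 + 2 * (norm (sqrt 2 *\<^sub>R (u $ 1 * qcnj (u $ 2))))\<^sup>2"
    unfolding B proj_emb_form[OF u(2)] p_def[symmetric] case_prod_conv by (rule E_inner_form)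
  moreover have "2 * (sqrt 2 * (p - 1/2))\<^sup>2 + 2 * (2 * (p * (1 - p))) = 1"
    unfolding power_mult_distrib by (simp add: power2_eq_square algebra_simps)
  ultimately have "B \<in> traceless_Herm D" "E_inner B B = 1" by simp_all
  then show "B \<in> E_sphere D" by (simp add: E_sphere_def)
next
  fix B assume "B \<in> E_sphere D"
  then obtain t b where b: "b \<in> D"
    and B: "B = vector [vector [of_real t, b], vector [qcnj b, - of_real t]]" and "E_inner B B = 1"
    by (auto simp: E_sphere_def traceless_Herm_eq[OF D])
  then have tb: "2 * t\<^sup>2 + 2 * (norm b)\<^sup>2 = 1" using E_inner_form[of t b] by simp
  define p where "p = t / sqrt 2 + 1/2"
  have t: "t = sqrt 2 * (p - 1/2)" by (simp add: p_def field_simps)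
  have "2 * t\<^sup>2 = 4 * (p - 1/2)\<^sup>2" by (simp add: t power_mult_distrib)
  then have nb: "(norm b)\<^sup>2 = 2 * (p * (1 - p))"
    using tb by (simp add: power2_eq_square algebra_simps)
  have sD: "r *\<^sub>R a \<in> D" if "a \<in> D" for r a using that subspace_scale[OF RCH_subspace[OF D]] by blast
  show "B \<in> proj_emb ` unit_vecs D"
  proof (cases "p = 0")
    case True
    define u :: "quat^2" where "u = vector [0, 1]"
    have nu: "norm u = 1" by (rule norm_eq_1_if_sq) (simp add: norm_sq_vec2 u_def)
    moreover have "b = 0" using nb True by simp
    ultimately have "B = proj_emb u" unfolding proj_emb_form[OF nu] by (simp add: B t True u_def)
    moreover have "u \<in> unit_vecs D"
      using nu RCH_closed(1)[OF D, of 0] RCH_closed(2)[OF D] by (simp add: unit_vecs_def u_def forall_2)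
    ultimately show ?thesis by blast
  next
    case False
    have "p * (1 - p) \<ge> 0" using nb zero_le_power2[of "norm b"] by linarith
    then have p: "p > 0" using False by (auto simp: zero_le_mult_iff)
    define u :: "quat^2" where
      "u = vector [of_real (sqrt p), (1 / (sqrt 2 * sqrt p)) *\<^sub>R qcnj b]"
    have nc: "norm (qcnj b) = norm b" by (simp add: norm_quat_def inner_quat_def)
    have "(norm u)\<^sup>2 = p + (norm b)\<^sup>2 / (2 * p)"
      unfolding norm_sq_vec2 using p by (simp add: u_def nc power_mult_distrib power_divide)
    also have "\<dots> = 1" using p by (simp add: nb)
    finally have nu: "norm u = 1" by (rule norm_eq_1_if_sq)
    have "sqrt 2 *\<^sub>R (u $ 1 * qcnj (u $ 2)) = b"
      using p by (simp add: u_def quat_eq_iff)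
    moreover have "(norm (u $ 1))\<^sup>2 = p" using p by (simp add: u_def)
    ultimately have "B = proj_emb u" unfolding proj_emb_form[OF nu] by (simp add: B t)
    moreover have "u \<in> unit_vecs D"
      using nu RCH_closed(1,4)[OF D] sD b by (simp add: unit_vecs_def u_def forall_2)
    ultimately show ?thesis by blast
  qed
qed

lemma proj_emb_eq_iff:
  assumes D: "D \<in> RCH" and u: "u \<in> unit_vecs D" and v: "v \<in> unit_vecs D"
  shows "proj_emb u = proj_emb v \<longleftrightarrow> (\<exists>a\<in>D. norm a = 1 \<and> v = (\<chi> i. u $ i * a))"
proof -
  have eq: "proj_emb u = proj_emb v \<longleftrightarrow> (\<forall>i j. u $ i * qcnj (u $ j) = v $ i * qcnj (v $ j))"
    by (simp add: proj_emb_def vec_eq_iff)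
  have n: "qcnj (v $ 1) * v $ 1 + qcnj (v $ 2) * v $ 2 = 1"
  proof -
    have "(norm (v $ 1))\<^sup>2 + (norm (v $ 2))\<^sup>2 = 1"
      using v norm_sq_vec2[of v] by (simp add: unit_vecs_def)
    then show ?thesis by (simp only: qcnj_mult_self of_real_add[symmetric] of_real_1)
  qed
  show ?thesis
  proof
    assume "proj_emb u = proj_emb v"
    then have e: "u $ i * qcnj (u $ j) = v $ i * qcnj (v $ j)" for i j using eq by blast
    define a where "a = qcnj (u $ 1) * v $ 1 + qcnj (u $ 2) * v $ 2"
    have "v $ i = v $ i * (qcnj (v $ 1) * v $ 1 + qcnj (v $ 2) * v $ 2)" for i by (simp add: n)
    then have vi: "v $ i = u $ i * a" for i
      unfolding a_def distrib_left mult.assoc[symmetric] e by simp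
    have "(norm v)\<^sup>2 = (norm u)\<^sup>2 * (norm a)\<^sup>2"
      unfolding norm_sq_vec2 vi norm_mult power_mult_distrib by (simp add: algebra_simps)
    then have "norm a = 1" using u v by (intro norm_eq_1_if_sq) (simp add: unit_vecs_def)
    moreover have "a \<in> D"
      using u v RCH_closed[OF D] subspace_add[OF RCH_subspace[OF D]]
      by (auto simp: a_def unit_vecs_def)
    ultimately show "\<exists>a\<in>D. norm a = 1 \<and> v = (\<chi> i. u $ i * a)"
      using vi by (auto simp: vec_eq_iff)
  next
    assume "\<exists>a\<in>D. norm a = 1 \<and> v = (\<chi> i. u $ i * a)"
    then obtain a where a: "norm a = 1" "v = (\<chi> i. u $ i * a)" by blast
    have "v $ i * qcnj (v $ j) = u $ i * (a * qcnj a) * qcnj (u $ j)" for i j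
      by (simp add: a(2) qcnj_mult mult.assoc)
    then show "proj_emb u = proj_emb v" by (simp add: eq mult_qcnj a(1))
  qed
qed


section \<open>Spherical designs and regular simplices\<close>

text \<open>The normalised surface measure, as the image of the uniform distribution on the unit ball
  under radial projection.\<close>

definition sphere_measure :: "'v::euclidean_space measure"
  where "sphere_measure = distr (uniform_measure lborel (ball 0 1)) borel (\<lambda>x. x /\<^sub>R norm x)"

definition poly_degree_le :: "nat \<Rightarrow> ('v::euclidean_space \<Rightarrow> real) \<Rightarrow> bool"
  where "poly_degree_le k f \<longleftrightarrow>
    (\<exists>(M :: ('v \<Rightarrow> nat) set) c. finite M \<and> (\<forall>m\<in>M. (\<Sum>i\<in>Basis. m i) \<le> k) \<and>
      f = (\<lambda>x. \<Sum>m\<in>M. c m * (\<Prod>i\<in>Basis. (x \<bullet> i) ^ m i)))"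

definition spherical_design :: "nat \<Rightarrow> 'v::euclidean_space set \<Rightarrow> bool"
  where "spherical_design t X \<longleftrightarrow>
    finite X \<and> X \<noteq> {} \<and> X \<subseteq> sphere 0 1 \<and>
    (\<forall>f. poly_degree_le t f \<longrightarrow>
      (\<Sum>x\<in>X. f x) / real (card X) = (\<integral>x. f x \<partial>sphere_measure))"

definition regular_simplex_vertices :: "nat \<Rightarrow> 'a::euclidean_space set \<Rightarrow> bool"
  where "regular_simplex_vertices k C \<longleftrightarrow>
    finite C \<and> card C = k + 1 \<and> \<not> affine_dependent C \<and>
    (\<exists>l. \<forall>x\<in>C. \<forall>y\<in>C. x \<noteq> y \<longrightarrow> dist x y = l)"

end

(* By the Cauchy-Schwarz inequality every defect satisfies |Z|^2 <= 1/2.  The trace of the second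
   moment identity is sum_i w_i |Z_i|^2 = r / (2 (q + 1)), so optimality of the correction weight
   forces |Z_i|^2 = 1/2 on all correction orbits.  Put a_i = w_i (q + 1) / r and Y_i = sqrt 2 Z_i.
   The two moment identities then say exactly that the vectors sqrt a_i (1, sqrt r Y_i) form a
   Parseval frame of R x E, a space of dimension r + 1.  A Parseval frame has at least as many
   members as the dimension, and it is an orthonormal basis in the case of equality; orthonormality
   gives a_i = 1 / (r + 1) and <Y_i, Y_j> = - 1 / r for distinct i, j. *)

theory Submission
  imports Defs
begin

section \<open>Parseval frames\<close>

text \<open>The error \<open>e\<close> of the expansion stays in \<open>U\<close>, so the frame
  identity may be applied to the pair \<open>v\<close>, \<open>e\<close>; it shows that
  \<open>e\<close> is orthogonal to itself. Working relative to a subspace \<open>U\<close> matters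
  later, where \<open>U\<close> is a proper subspace of the ambient type.\<close>

lemma parseval_frame_expansion:
  fixes u :: "'i \<Rightarrow> 'a::euclidean_space"
  assumes U: "subspace U" and u: "\<And>i. i \<in> I \<Longrightarrow> u i \<in> U"
    and frame: "\<And>v v'. v \<in> U \<Longrightarrow> v' \<in> U \<Longrightarrow> (\<Sum>i\<in>I. (v \<bullet> u i) * (v' \<bullet> u i)) = v \<bullet> v'"
    and v: "v \<in> U"
  shows "v = (\<Sum>i\<in>I. (v \<bullet> u i) *\<^sub>R u i)"
proof -
  define e where "e = v - (\<Sum>i\<in>I. (v \<bullet> u i) *\<^sub>R u i)"
  have eU: "e \<in> U"
    unfolding e_def by (intro subspace_diff[OF U] v subspace_sum[OF U] subspace_scale[OF U] u)
  have "e \<bullet> e = e \<bullet> v - (\<Sum>i\<in>I. (v \<bullet> u i) * (e \<bullet> u i))"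
    by (subst (2) e_def) (simp add: inner_diff_right inner_sum_right)
  also have "\<dots> = 0" using frame[OF v eU] by (simp add: inner_commute)
  finally show ?thesis by (simp add: e_def)
qed

lemma parseval_frame_span:
  fixes u :: "'i \<Rightarrow> 'a::euclidean_space"
  assumes "subspace U" "\<And>i. i \<in> I \<Longrightarrow> u i \<in> U"
    and "\<And>v v'. v \<in> U \<Longrightarrow> v' \<in> U \<Longrightarrow> (\<Sum>i\<in>I. (v \<bullet> u i) * (v' \<bullet> u i)) = v \<bullet> v'"
  shows "span (u ` I) = U"
proof
  show "span (u ` I) \<subseteq> U" using assms(1,2) by (intro span_minimal) auto
  show "U \<subseteq> span (u ` I)"
  proof
    fix v assume "v \<in> U"
    then have "v = (\<Sum>i\<in>I. (v \<bullet> u i) *\<^sub>R u i)"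
      using assms by (intro parseval_frame_expansion)
    also have "\<dots> \<in> span (u ` I)" by (intro span_sum span_scale span_base) auto
    finally show "v \<in> span (u ` I)" .
  qed
qed

lemma parseval_frame_card_ge_dim:
  fixes u :: "'i \<Rightarrow> 'a::euclidean_space"
  assumes "finite I" "subspace U" "\<And>i. i \<in> I \<Longrightarrow> u i \<in> U"
    and "\<And>v v'. v \<in> U \<Longrightarrow> v' \<in> U \<Longrightarrow> (\<Sum>i\<in>I. (v \<bullet> u i) * (v' \<bullet> u i)) = v \<bullet> v'"
  shows "dim U \<le> card I"
proof -
  have "span (u ` I) = U" using assms by (intro parseval_frame_span)
  then have "dim U \<le> card (u ` I)" using assms(1) by (metis dim_span dim_le_card' finite_imageI)
  then show ?thesis using card_image_le[OF assms(1)] le_trans by blast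
qed

text \<open>A spanning family with \<open>dim U\<close> members is injective and independent. Hence
  the frame expansion of \<open>u i\<close> has to coincide with the trivial expansion of
  \<open>u i\<close> as itself, and comparing coefficients gives the inner products.\<close>

lemma parseval_frame_orthonormal:
  fixes u :: "'i \<Rightarrow> 'a::euclidean_space"
  assumes fin: "finite I" and U: "subspace U" and u: "\<And>i. i \<in> I \<Longrightarrow> u i \<in> U"
    and frame: "\<And>v v'. v \<in> U \<Longrightarrow> v' \<in> U \<Longrightarrow> (\<Sum>i\<in>I. (v \<bullet> u i) * (v' \<bullet> u i)) = v \<bullet> v'"
    and card: "card I = dim U" and ij: "i \<in> I" "j \<in> I"
  shows "u i \<bullet> u j = (if i = j then 1 else 0)"
proof -
  have sp: "span (u ` I) = U" using U u frame by (intro parseval_frame_span)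
  \<comment> \<open>A spanning set of \<open>U\<close> has at least \<open>dim U\<close> members, so
    \<open>u\<close> cannot identify two indices.\<close>
  then have "card I \<le> card (u ` I)"
    unfolding card using fin by (metis dim_span dim_le_card' finite_imageI)
  then have cI: "card (u ` I) = card I" using card_image_le[OF fin, of u] by simp
  then have inj: "inj_on u I" using fin by (intro eq_card_imp_inj_on)
  have ind: "independent (u ` I)"
    using sp cI card fin by (intro card_le_dim_spanning[of _ U]) (auto intro: span_base)
  define k where "k v = (u i \<bullet> v) - (if v = u i then 1 else 0)" for v
  have "(\<Sum>l\<in>I. k (u l) *\<^sub>R u l) = (\<Sum>l\<in>I. (u i \<bullet> u l) *\<^sub>R u l) - (\<Sum>l\<in>I. if l = i then u i else 0)"
    unfolding sum_subtractf[symmetric] k_def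
    using inj ij(1) by (intro sum.cong) (auto simp: algebra_simps inj_on_eq_iff)
  also have "\<dots> = 0"
    using parseval_frame_expansion[of U I u "u i", OF U u frame u[OF ij(1)]] ij(1) fin by simp
  finally have "(\<Sum>v\<in>u ` I. k v *\<^sub>R v) = 0" using inj by (simp add: sum.reindex)
  then have "k (u j) = 0"
    using ind fin ij(2) by (auto simp: independent_explicit)
  then show ?thesis using inj ij by (auto simp: k_def inj_on_eq_iff)
qed


section \<open>Weighted spherical designs of strength two\<close>

text \<open>This is the trace of the second moment identity: set \<open>v\<close> and
  \<open>v'\<close> both equal to \<open>b\<close>, sum over an orthonormal basis of
  \<open>E\<close>, and collect the squared coefficients by Parseval.\<close>

lemma sum_norm_sq_of_isotropic:
  fixes z :: "'i \<Rightarrow> 'a::euclidean_space"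
  assumes E: "subspace E" and z: "\<And>i. i \<in> A \<Longrightarrow> z i \<in> E"
    and sm: "\<And>v v'. v \<in> E \<Longrightarrow> v' \<in> E \<Longrightarrow> (\<Sum>i\<in>A. a i * (v \<bullet> z i) * (v' \<bullet> z i)) = c * (v \<bullet> v')"
  shows "(\<Sum>i\<in>A. a i * (norm (z i))\<^sup>2) = c * dim E"
proof -
  obtain B where B: "B \<subseteq> E" "pairwise orthogonal B" "\<And>b. b \<in> B \<Longrightarrow> norm b = 1"
      "independent B" "card B = dim E" "span B = E"
    using orthonormal_basis_subspace[OF E] by metis
  have fB: "finite B" using B(4) by (rule independent_imp_finite)
  have bb: "b \<bullet> b' = (if b = b' then 1 else 0)" if "b \<in> B" "b' \<in> B" for b b'
    using B(2,3) that by (auto simp: pairwise_def orthogonal_def norm_eq_1)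
  have parseval: "(norm v)\<^sup>2 = (\<Sum>b\<in>B. (b \<bullet> v)\<^sup>2)" if v: "v \<in> E" for v
  proof -
    obtain f where f: "v = (\<Sum>b\<in>B. f b *\<^sub>R b)"
      using v B(6) span_finite[OF fB] by auto
    have bv: "b \<bullet> v = f b" if "b \<in> B" for b
    proof -
      have "b \<bullet> v = (\<Sum>b'\<in>B. f b' * (b \<bullet> b'))" unfolding f by (simp add: inner_sum_right)
      also have "\<dots> = (\<Sum>b'\<in>B. if b = b' then f b' else 0)"
        using that by (intro sum.cong) (auto simp: bb)
      also have "\<dots> = f b" using that fB by simp
      finally show ?thesis .
    qed
    have "(norm v)\<^sup>2 = (\<Sum>b\<in>B. f b * (b \<bullet> v))"
      unfolding power2_norm_eq_inner by (subst f) (simp add: inner_sum_left)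
    then show ?thesis using bv by (simp add: power2_eq_square)
  qed
  have "(\<Sum>i\<in>A. a i * (norm (z i))\<^sup>2) = (\<Sum>i\<in>A. \<Sum>b\<in>B. a i * (b \<bullet> z i)\<^sup>2)"
    by (simp add: parseval z sum_distrib_left)
  also have "\<dots> = (\<Sum>b\<in>B. \<Sum>i\<in>A. a i * (b \<bullet> z i) * (b \<bullet> z i))"
    by (subst sum.swap) (simp add: power2_eq_square mult.assoc)
  also have "\<dots> = (\<Sum>b\<in>B. c * (b \<bullet> b))" using B(1) by (intro sum.cong sm) auto
  also have "\<dots> = c * dim E" using B(5) by (simp add: bb)
  finally show ?thesis .
qed

text \<open>The abstract form of the normalized correction orbits. The vectors form an indexed
  family, so coincidences are allowed at first; they are excluded in the equality case by
  \<open>inj_y\<close>.\<close>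

locale weighted_two_design =
  fixes E :: "'a::euclidean_space set" and I :: "'i set" and a :: "'i \<Rightarrow> real" and y :: "'i \<Rightarrow> 'a"
  assumes subspace_E: "subspace E" and dim_E: "dim E > 0" and finite_I: "finite I"
    and in_E: "\<And>i. i \<in> I \<Longrightarrow> y i \<in> E" and unit: "\<And>i. i \<in> I \<Longrightarrow> norm (y i) = 1"
    and pos: "\<And>i. i \<in> I \<Longrightarrow> a i > 0" and sum_1: "(\<Sum>i\<in>I. a i) = 1"
    and first_moment: "(\<Sum>i\<in>I. a i *\<^sub>R y i) = 0"
    and second_moment: "\<And>v v'. v \<in> E \<Longrightarrow> v' \<in> E \<Longrightarrow>
      (\<Sum>i\<in>I. a i * (v \<bullet> y i) * (v' \<bullet> y i)) = (v \<bullet> v') / dim E"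
begin

text \<open>The extra coordinate 1 encodes the total weight and the first moment, the factor
  \<open>sqrt (dim E)\<close> cancels the denominator of the second moment, and
  \<open>sqrt (a i)\<close> becomes the weight \<open>a i\<close> in quadratic expressions.\<close>

definition lift :: "'i \<Rightarrow> real \<times> 'a"
  where "lift i = sqrt (a i) *\<^sub>R (1, sqrt (dim E) *\<^sub>R y i)"

lemma inner_lift:
  assumes "i \<in> I"
  shows "(t, v) \<bullet> lift i = sqrt (a i) * (t + sqrt (dim E) * (v \<bullet> y i))"
  by (simp add: lift_def inner_Pair algebra_simps)

text \<open>The product of two coefficients has four terms. After summation the constant one gives
  \<open>t * t'\<close> because the weights sum to 1, the two mixed ones vanish by the first moment,
  and the last is \<open>v\<close> paired with \<open>v'\<close> by the second moment.\<close>

lemma lift_frame: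
  assumes "p \<in> UNIV \<times> E" "p' \<in> UNIV \<times> E"
  shows "(\<Sum>i\<in>I. (p \<bullet> lift i) * (p' \<bullet> lift i)) = p \<bullet> p'"
proof -
  obtain t v t' v' where p: "p = (t, v)" "p' = (t', v')" "v \<in> E" "v' \<in> E" using assms by auto
  let ?s = "sqrt (dim E)"
  have fm: "(\<Sum>i\<in>I. a i * (u \<bullet> y i)) = 0" for u
  proof -
    have "(\<Sum>i\<in>I. a i * (u \<bullet> y i)) = u \<bullet> (\<Sum>i\<in>I. a i *\<^sub>R y i)" by (simp add: inner_sum_right)
    then show ?thesis by (simp add: first_moment)
  qed
  have ss: "?s * ?s = dim E" by simp
  have "(p \<bullet> lift i) * (p' \<bullet> lift i) = t * t' * a i + t * ?s * (a i * (v' \<bullet> y i))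
      + t' * ?s * (a i * (v \<bullet> y i)) + dim E * (a i * (v \<bullet> y i) * (v' \<bullet> y i))" if i: "i \<in> I" for i
  proof -
    have "sqrt (a i) * sqrt (a i) = a i" using pos[OF i] by simp
    then have "(p \<bullet> lift i) * (p' \<bullet> lift i) = a i * ((t + ?s * (v \<bullet> y i)) * (t' + ?s * (v' \<bullet> y i)))"
      unfolding p inner_lift[OF i] by (metis mult.assoc mult.left_commute)
    also have "\<dots> = t * t' * a i + t * ?s * (a i * (v' \<bullet> y i)) + t' * ?s * (a i * (v \<bullet> y i))
        + (?s * ?s) * (a i * (v \<bullet> y i) * (v' \<bullet> y i))" by (simp only: algebra_simps)
    finally show ?thesis unfolding ss .
  qed
  then have "(\<Sum>i\<in>I. (p \<bullet> lift i) * (p' \<bullet> lift i)) = t * t' * (\<Sum>i\<in>I. a i)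
      + t * ?s * (\<Sum>i\<in>I. a i * (v' \<bullet> y i)) + t' * ?s * (\<Sum>i\<in>I. a i * (v \<bullet> y i))
      + dim E * (\<Sum>i\<in>I. a i * (v \<bullet> y i) * (v' \<bullet> y i))"
    by (simp add: sum.distrib sum_distrib_left)
  also have "\<dots> = t * t' + v \<bullet> v'" unfolding fm sum_1 second_moment[OF p(3,4)] using dim_E by (simp del: dim_eq_0)
  finally show ?thesis by (simp add: p inner_Pair)
qed

lemma subspace_lift: "subspace ((UNIV :: real set) \<times> E)"
  by (intro subspace_Times subspace_UNIV subspace_E)

lemma dim_lift: "dim ((UNIV :: real set) \<times> E) = dim E + 1"
  using dim_Times[OF subspace_UNIV subspace_E, where 'a = real] by (simp add: dim_UNIV)

lemma lift_mem: "i \<in> I \<Longrightarrow> lift i \<in> UNIV \<times> E"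
  using in_E subspace_scale[OF subspace_E] by (simp add: lift_def)

lemma card_ge: "card I \<ge> dim E + 1"
  using parseval_frame_card_ge_dim[OF finite_I subspace_lift lift_mem lift_frame] by (simp add: dim_lift)

section \<open>The equality case: the lifted vectors form an orthonormal basis\<close>

context
  assumes tight: "card I = dim E + 1"
begin

lemma lift_orthonormal:
  assumes "i \<in> I" "j \<in> I"
  shows "lift i \<bullet> lift j = (if i = j then 1 else 0)"
  using parseval_frame_orthonormal[OF finite_I subspace_lift lift_mem lift_frame _ assms]
  by (simp add: dim_lift tight)

lemma inner_lift_lift:
  assumes "i \<in> I" "j \<in> I"
  shows "lift i \<bullet> lift j = sqrt (a i) * sqrt (a j) * (1 + dim E * (y i \<bullet> y j))"
  by (simp add: lift_def inner_Pair algebra_simps)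

lemma weight_eq:
  assumes "i \<in> I"
  shows "a i = 1 / (dim E + 1)"
proof -
  have "y i \<bullet> y i = 1" using unit[OF assms] by (simp add: norm_eq_1)
  then have "a i * (1 + dim E) = 1"
    using lift_orthonormal[OF assms assms] pos[OF assms] by (simp add: inner_lift_lift[OF assms assms])
  then show ?thesis by (simp add: field_simps)
qed

lemma inner_eq:
  assumes "i \<in> I" "j \<in> I" "i \<noteq> j"
  shows "y i \<bullet> y j = - 1 / dim E"
proof -
  \<comment> \<open>Positivity of the weights allows the factor
    \<open>sqrt (a i) * sqrt (a j)\<close> to be cancelled.\<close>
  have "1 + dim E * (y i \<bullet> y j) = 0"
    using lift_orthonormal[OF assms(1,2)] pos[OF assms(1)] pos[OF assms(2)] assms(3)
    by (simp add: inner_lift_lift[OF assms(1,2)])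
  then show ?thesis using dim_E by (simp add: field_simps del: dim_eq_0)
qed

text \<open>Unit vectors that coincide have inner product 1, whereas distinct indices give a
  negative one.\<close>

lemma inj_y: "inj_on y I"
proof (rule inj_onI, rule ccontr)
  fix i j assume ij: "i \<in> I" "j \<in> I" "y i = y j" "i \<noteq> j"
  then have "1 = - 1 / real (dim E)" using inner_eq[OF ij(1,2,4)] unit[OF ij(2)] by (simp add: norm_eq_1)
  then show False using dim_E by (simp add: field_simps del: dim_eq_0)
qed

text \<open>Everything follows from the Gram matrix, which has 1 on the diagonal and
  \<open>- 1 / dim E\<close> elsewhere.\<close>

lemma regular_simplex: "regular_simplex_vertices (dim E) (y ` I)"
  unfolding regular_simplex_vertices_def
proof (intro conjI)
  show fC: "finite (y ` I)" using finite_I by simp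
  show "card (y ` I) = dim E + 1" using card_image[OF inj_y] tight by simp
  have ip: "v \<bullet> v' = (if v = v' then 1 else - 1 / dim E)" if "v \<in> y ` I" "v' \<in> y ` I" for v v'
    using that inner_eq unit by (auto simp: norm_eq_1)
  show "\<not> affine_dependent (y ` I)"
  proof
    assume "affine_dependent (y ` I)"
    then obtain c v where c: "sum c (y ` I) = 0" "v \<in> y ` I" "c v \<noteq> 0" "(\<Sum>v\<in>y ` I. c v *\<^sub>R v) = 0"
      using affine_dependent_explicit_finite[OF fC] by auto
    \<comment> \<open>Pair the affine relation with \<open>v\<close>. Letting the off-diagonal value
      run over all points, \<open>v\<close> included, produces a multiple of the coefficient sum,
      which is 0; only the surplus \<open>1 + 1 / dim E\<close> at \<open>v\<close>
      survives.\<close>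
    have "0 = v \<bullet> (\<Sum>v\<in>y ` I. c v *\<^sub>R v)" by (simp add: c(4))
    also have "\<dots> = (\<Sum>v'\<in>y ` I. c v' * (v \<bullet> v'))" by (simp add: inner_sum_right)
    also have "\<dots> = (\<Sum>v'\<in>y ` I. (if v = v' then c v' * (1 + 1 / dim E) else 0) - c v' / dim E)"
      by (intro sum.cong) (auto simp: ip[OF c(2)] algebra_simps)
    also have "\<dots> = c v * (1 + 1 / dim E) - sum c (y ` I) / dim E"
      using c(2) fC by (simp add: sum_subtractf sum_divide_distrib)
    finally have "c v * (1 + 1 / dim E) = 0" using c(1) by simp
    moreover have "1 + 1 / real (dim E) > 0" by (simp add: add_pos_nonneg)
    ultimately show False using c(3) by simp
  qed
  have "dist v v' = sqrt (2 + 2 / dim E)" if "v \<in> y ` I" "v' \<in> y ` I" "v \<noteq> v'" for v v'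
  proof -
    have "(v - v') \<bullet> (v - v') = v \<bullet> v + v' \<bullet> v' - 2 * (v \<bullet> v')"
      by (simp add: inner_diff inner_commute)
    also have "\<dots> = 2 + 2 / dim E" using that by (simp add: ip)
    finally show ?thesis by (simp add: dist_norm norm_eq_sqrt_inner)
  qed
  then show "\<exists>l. \<forall>v\<in>y ` I. \<forall>v'\<in>y ` I. v \<noteq> v' \<longrightarrow> dist v v' = l" by blast
qed

end

end


section \<open>Quadratic defects\<close>

lemma invariant_hermitian_formD:
  assumes "invariant_hermitian_form G \<rho> D rmul h"
  shows "h x y \<in> D" "h y x = qcnj (h x y)" "qRe (h x y) = x \<bullet> y"
    "a \<in> D \<Longrightarrow> b \<in> D \<Longrightarrow> h (rmul x a) (rmul y b) = qcnj a * h x y * b"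
  using assms[unfolded invariant_hermitian_form_def] by blast+

text \<open>Scaling \<open>x\<close> on the right by \<open>a = h x y\<close> turns the value of the
  form into the real number \<open>qcnj a * a\<close>, so the real Cauchy-Schwarz inequality
  applies. Both sides then carry a factor \<open>norm a\<close>, which is cancelled at the
  end.\<close>

lemma hermitian_form_Cauchy_Schwarz:
  assumes D: "D \<in> RCH" and "invariant_hermitian_form G \<rho> D rmul h"
  shows "norm (h x y) \<le> norm x * norm y"
proof -
  note h = invariant_hermitian_formD[OF assms(2)]
  define a where "a = h x y"
  have a: "a \<in> D" unfolding a_def by (rule h)
  have one: "qcnj 1 = 1" by (simp add: quat_eq_iff)
  note re = h(3) and sesq = h(4)
  have "h x x = qcnj (h x x)" by (rule h)
  then have hxx: "h x x = of_real ((norm x)\<^sup>2)"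
    using re[of x x] by (simp add: quat_eq_iff power2_norm_eq_inner)
  have "rmul x a \<bullet> rmul x a = qRe (qcnj a * of_real ((norm x)\<^sup>2) * a)"
    unfolding re[symmetric] sesq[OF a a] hxx ..
  also have "qcnj a * of_real ((norm x)\<^sup>2) * a = (norm x)\<^sup>2 *\<^sub>R (qcnj a * a)"
    by (simp add: of_real_def)
  also have "qRe \<dots> = (norm x * norm a)\<^sup>2"
    by (simp only: qcnj_mult_self quat_sel_scaleR quat_sel_of_real power_mult_distrib)
  finally have nx: "norm (rmul x a) = norm x * norm a" by (simp add: norm_eq_sqrt_inner[of "rmul x a"])
  have "h (rmul x a) (rmul y 1) = qcnj a * a"
    using sesq[OF a RCH_closed(2)[OF D]] by (simp add: a_def)
  then have "(norm a)\<^sup>2 = rmul x a \<bullet> rmul y 1"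
    using re[of "rmul x a" "rmul y 1"] by (simp only: qcnj_mult_self quat_sel_of_real)
  also have "\<dots> \<le> norm (rmul x a) * norm (rmul y 1)" by (rule norm_cauchy_schwarz)
  \<comment> \<open>The length of \<open>rmul y 1\<close> is read off from the form itself, through
    sesquilinearity at the scalar 1.\<close>
  also have "norm (rmul y 1) = norm y"
  proof -
    have "h (rmul y 1) (rmul y 1) = h y y"
      using sesq[OF RCH_closed(2)[OF D] RCH_closed(2)[OF D], of y y] one by simp
    then show ?thesis by (metis re norm_eq_sqrt_inner)
  qed
  finally have "norm a * norm a \<le> norm a * (norm x * norm y)"
    by (simp add: nx power2_eq_square mult.commute mult.left_commute)
  then show ?thesis
    unfolding a_def[symmetric] by (cases "a = 0") simp_all
qed

text \<open>With \<open>p\<close> the squared length of the first component and \<open>b\<close> the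
  off-diagonal entry, the squared norm is \<open>2 * (p - 1/2)^2 + 2 * (norm b)^2\<close>.
  Cauchy-Schwarz bounds \<open>(norm b)^2\<close> by \<open>p * (1 - p)\<close>, and the terms in
  \<open>p\<close> then cancel to leave \<open>1/2\<close>.\<close>

lemma norm_defect_le:
  assumes D: "D \<in> RCH" and "invariant_hermitian_form G \<rho> D rmul h" and x: "x \<in> sphere 0 1"
  shows "(norm (defect h x))\<^sup>2 \<le> 1/2"
proof -
  define p where "p = (norm (fst x))\<^sup>2"
  define b where "b = h (fst x) (snd x)"
  have np: "(norm (snd x))\<^sup>2 = 1 - p"
    using x unfolding p_def by (simp add: norm_prod_def)
  have E: "defect h x \<in> traceless_Herm D" using assms by (rule defect_in_traceless_Herm)
  then obtain t c where Z: "defect h x = vector [vector [of_real t, c], vector [qcnj c, - of_real t]]"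
    unfolding traceless_Herm_eq[OF D] by auto
  have entries: "defect h x $ 1 $ 1 = h (fst x) (fst x) - (1/2) *\<^sub>R 1" "defect h x $ 1 $ 2 = b"
    by (simp_all add: defect_def gram_def mat_def b_def)
  have "qRe (h (fst x) (fst x)) = p"
    unfolding p_def power2_norm_eq_inner by (rule invariant_hermitian_formD(3)[OF assms(2)])
  then have "t = p - 1/2"
    using arg_cong[OF entries(1), of qRe] by (simp add: Z)
  moreover have "c = b" using entries(2) by (simp add: Z)
  moreover have "(norm (defect h x))\<^sup>2 = E_inner (defect h x) (defect h x)"
    using E E_inner_eq_inner[of "defect h x" D] by (simp add: traceless_Herm_def power2_norm_eq_inner)
  ultimately have "(norm (defect h x))\<^sup>2 = 2 * (p - 1/2)\<^sup>2 + 2 * (norm b)\<^sup>2"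
    by (simp only: Z E_inner_form)
  moreover have "(norm b)\<^sup>2 \<le> p * (1 - p)"
    using power_mono[OF hermitian_form_Cauchy_Schwarz[OF D assms(2), of "fst x" "snd x"] norm_ge_zero, of 2]
    unfolding power_mult_distrib np p_def[symmetric] b_def[symmetric] .
  ultimately show ?thesis by (simp add: power2_eq_square algebra_simps)
qed

section \<open>From the moment identities of the defects to a weighted design of unit
  vectors\<close>

theorem corollary5p5:
  fixes G :: "('g, 'm) monoid_scheme" and \<rho> :: "'g \<Rightarrow> 'w::euclidean_space \<Rightarrow> 'w"
    and D :: "quat set" and rmul :: "'w \<Rightarrow> quat \<Rightarrow> 'w" and h :: "'w \<Rightarrow> 'w \<Rightarrow> quat"
    and d n q r s :: nat
    and x :: "nat \<Rightarrow> 'w \<times> 'w" and w :: "nat \<Rightarrow> real"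
    and Z :: "nat \<Rightarrow> quat^2^2" and I :: "nat set"
  assumes G: "group G" "finite (carrier G)"
    and W: "orthogonal_rep G \<rho>" "irreducible_rep G \<rho>" "\<not> trivial_rep G \<rho>"
    and D: "D \<in> RCH" "right_scalars G \<rho> D rmul"
    and h: "invariant_hermitian_form G \<rho> D rmul h"
    and d: "d = dim D"
    and n: "n = right_dim D rmul"
    and q: "q = d * n"
    and r: "r = dim (traceless_Herm D)"
    and x: "\<forall>i\<in>{1..s}. x i \<in> sphere 0 1"
    and w: "\<forall>i\<in>{1..s}. w i > 0" "(\<Sum>i=1..s. w i) = 1"
    and Z: "Z = (\<lambda>i. defect h (x i))"
    and first_moment: "(\<Sum>i=1..s. w i *\<^sub>R Z i) = 0"
    and second_moment: "\<forall>B\<in>traceless_Herm D. \<forall>C\<in>traceless_Herm D.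
      (\<Sum>i=1..s. w i * E_inner B (Z i) * E_inner C (Z i)) = 1 / (2 * (real q + 1)) * E_inner B C"
    and design: "\<exists>i\<in>{1..s}. spherical_design 2 (orbit G (diag_action \<rho>) (x i))"
    and I: "I = {i\<in>{1..s}. Z i \<noteq> 0}"
    and optimal: "(\<Sum>i\<in>I. w i) = real r / (real q + 1)"
  shows "r = d + 1 \<and> card I \<ge> r + 1 \<and>
    (card I = r + 1 \<longrightarrow>
      (\<forall>i\<in>I. \<forall>j\<in>I. w i = w j) \<and>
      inj_on Z I \<and>
      (\<lambda>i. sqrt 2 *\<^sub>R Z i) ` I \<subseteq> E_sphere D \<and>
      regular_simplex_vertices r ((\<lambda>i. sqrt 2 *\<^sub>R Z i) ` I) \<and>
      (D = \<real> \<longrightarrow> r = 2) \<and> (D = quat_complex \<longrightarrow> r = 3) \<and> (D = UNIV \<longrightarrow> r = 5))"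
proof -
  let ?E = "traceless_Herm D"
  have sE: "subspace ?E" using D(1) by (rule subspace_traceless_Herm)
  have rd: "r = d + 1" unfolding r d using D(1) by (rule dim_traceless_Herm)
  then have r0: "real r > 0" by simp
  have ZE: "Z i \<in> ?E" if "i \<in> {1..s}" for i
    using defect_in_traceless_Herm[OF D(1) h] x that by (simp add: Z)
  have ip: "E_inner B C = B \<bullet> C" if "B \<in> ?E" for B C
    using that by (intro E_inner_eq_inner[of _ D]) (simp add: traceless_Herm_def)
  have fI: "finite I" and IS: "I \<subseteq> {1..s}" by (auto simp: I)
  \<comment> \<open>Zero defects contribute nothing to the moments. The value type is left general
    because both scalar and matrix sums are restricted.\<close>
  have restrict: "(\<Sum>i\<in>I. f i) = (\<Sum>i=1..s. f i)" if "\<And>i. Z i = 0 \<Longrightarrow> f i = 0"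
    for f :: "nat \<Rightarrow> 'z::comm_monoid_add"
    using that by (intro sum.mono_neutral_left) (auto simp: I)
  have sm: "(\<Sum>i\<in>I. w i * (B \<bullet> Z i) * (C \<bullet> Z i)) = 1 / (2 * (real q + 1)) * (B \<bullet> C)"
    if "B \<in> ?E" "C \<in> ?E" for B C
    using second_moment that by (subst restrict) (auto simp: ip)
  have "(\<Sum>i\<in>I. w i * (norm (Z i))\<^sup>2) = 1 / (2 * (real q + 1)) * real (dim ?E)"
    using IS by (intro sum_norm_sq_of_isotropic sE sm ZE) auto
  then have "(\<Sum>i\<in>I. w i * (norm (Z i))\<^sup>2) = (\<Sum>i\<in>I. w i) * (1 / 2)"
    unfolding optimal r by simp
  \<comment> \<open>A sum of terms that are nonnegative by \<open>norm_defect_le\<close>; its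
    vanishing forces every correction orbit to attain the bound.\<close>
  then have "(\<Sum>i\<in>I. w i * (1 / 2 - (norm (Z i))\<^sup>2)) = 0"
    by (simp only: right_diff_distrib sum_subtractf sum_distrib_right diff_self)
  moreover have "w i * (1 / 2 - (norm (Z i))\<^sup>2) \<ge> 0" if "i \<in> I" for i
  proof -
    have "x i \<in> sphere 0 1" using x that IS by blast
    then have "(norm (Z i))\<^sup>2 \<le> 1 / 2" unfolding Z by (rule norm_defect_le[OF D(1) h])
    then show ?thesis using w(1) that IS by (intro mult_nonneg_nonneg) (auto intro: less_imp_le)
  qed
  ultimately have "\<forall>i\<in>I. w i * (1 / 2 - (norm (Z i))\<^sup>2) = 0"
    using sum_nonneg_eq_0_iff[OF fI, of "\<lambda>i. w i * (1 / 2 - (norm (Z i))\<^sup>2)"] by simp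
  then have nZ: "(norm (Z i))\<^sup>2 = 1 / 2" if "i \<in> I" for i
    using that w(1) IS by fastforce
  \<comment> \<open>The factor is the reciprocal of the total correction weight, so the
    \<open>a i\<close> sum to 1; \<open>sqrt 2\<close> in \<open>y\<close> makes defects of squared
    norm \<open>1/2\<close> into unit vectors.\<close>
  define a where "a i = w i * ((real q + 1) / real r)" for i
  define y where "y i = sqrt 2 *\<^sub>R Z i" for i
  interpret weighted_two_design ?E I a y
  proof
    show "subspace ?E" "finite I" by fact+
    show "dim ?E > 0" using rd r by simp
    show yE: "y i \<in> ?E" if "i \<in> I" for i
      unfolding y_def using ZE IS that by (intro subspace_scale[OF sE]) auto
    show "norm (y i) = 1" if "i \<in> I" for i
      by (rule norm_eq_1_if_sq) (simp add: y_def power_mult_distrib nZ[OF that])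
    show "a i > 0" if "i \<in> I" for i
      using w(1) that IS r0 by (auto simp: a_def)
    show "(\<Sum>i\<in>I. a i) = 1"
      unfolding a_def sum_distrib_right[symmetric] optimal using r0 by simp
    have "(\<Sum>i\<in>I. a i *\<^sub>R y i) = (sqrt 2 * ((real q + 1) / real r)) *\<^sub>R (\<Sum>i\<in>I. w i *\<^sub>R Z i)"
      by (simp add: a_def y_def scaleR_sum_right mult_ac)
    also have "(\<Sum>i\<in>I. w i *\<^sub>R Z i) = 0" using first_moment by (subst restrict) auto
    finally show "(\<Sum>i\<in>I. a i *\<^sub>R y i) = 0" by simp
    show "(\<Sum>i\<in>I. a i * (v \<bullet> y i) * (v' \<bullet> y i)) = (v \<bullet> v') / real (dim ?E)"
      if v: "v \<in> ?E" "v' \<in> ?E" for v v'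
    proof -
      have "a i * (v \<bullet> y i) * (v' \<bullet> y i) = 2 * ((real q + 1) / real r) * (w i * (v \<bullet> Z i) * (v' \<bullet> Z i))" for i
      proof -
        have "a i * (v \<bullet> y i) * (v' \<bullet> y i)
          = (sqrt 2 * sqrt 2) * ((real q + 1) / real r) * (w i * (v \<bullet> Z i) * (v' \<bullet> Z i))"
          unfolding a_def y_def inner_scaleR_right by (simp only: mult_ac)
        then show ?thesis by simp
      qed
      \<comment> \<open>The 2 coming from the two factors \<open>sqrt 2\<close> and the
        \<open>q + 1\<close> from the normalized weights cancel the constant of the second moment
        identity, leaving \<open>1 / r\<close>.\<close>
      then have "(\<Sum>i\<in>I. a i * (v \<bullet> y i) * (v' \<bullet> y i))
          = 2 * ((real q + 1) / real r) * (1 / (2 * (real q + 1)) * (v \<bullet> v'))"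
        by (simp only: sum_distrib_left[symmetric] sm[OF v])
      also have "\<dots> = (v \<bullet> v') / real r"
      proof -
        have "real q + 1 \<noteq> 0" by linarith
        then show ?thesis using r0 by (simp add: divide_simps)
      qed
      finally show ?thesis by (simp add: r)
    qed
  qed
  have yI: "(\<lambda>i. sqrt 2 *\<^sub>R Z i) = y" by (simp add: y_def fun_eq_iff)
  show ?thesis
    unfolding yI
  proof (intro conjI impI ballI)
    show "r = d + 1" by (rule rd)
    show "card I \<ge> r + 1" using card_ge by (simp add: r)
    show "y ` I \<subseteq> E_sphere D"
      using in_E unit by (auto simp: E_sphere_def ip norm_eq_1)
    assume "card I = r + 1"
    then have t: "card I = dim ?E + 1" by (simp add: r)
    show "w i = w j" if "i \<in> I" "j \<in> I" for i j
    proof -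
      have "a i = a j" using weight_eq[OF t] that by simp
      moreover have "(real q + 1) / real r \<noteq> 0" using r0 by (simp add: add_eq_0_iff_both_eq_0)
      ultimately show ?thesis unfolding a_def using mult_right_cancel by blast
    qed
    show "inj_on Z I" using inj_y[OF t] by (auto simp: inj_on_def y_def)
    show "regular_simplex_vertices r (y ` I)" using regular_simplex[OF t] by (simp add: r)
    show "r = 2" if "D = \<real>" using rd d dim_RCH(1) that by simp
    show "r = 3" if "D = quat_complex" using rd d dim_RCH(2) that by simp
    show "r = 5" if "D = UNIV" using rd d dim_RCH(3) that by (simp del: dim_UNIV)
  qed
qed

end
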